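(* Let $H$ be a bipartite graph with bipartition $X\cup Y$ such that every vertex of $Y$ has degree at most $2$, and suppose $H$ contains no copy of $C_4$. Then there exist positive constants $C$ and $\delta$ such that for all $n$, \[\mathrm{ex}(n,H) \leq C n^{3/2 - \delta}.\]
   Context: For a graph $H$ and a natural number $n$, the extremal number $\mathrm{ex}(n,H)$ is the largest number of edges in an $n$-vertex graph containing no copy of $H$ (as a subgraph). "Maximum degree two on one side" means that all vertices in one of the two parts of the bipartition have degree at most $2$. *)

theory Defs
  imports Complex_Main
begin

type_synonym 'a ugraph = "'a set \<times> 'a set set"

abbreviation verts :: "'a ugraph \<Rightarrow> 'a set" where
  "verts G \<equiv> fst G"

abbreviation edges :: "'a ugraph \<Rightarrow> 'a set set" where
  "edges G \<equiv> snd G"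

definition simple_graph :: "'a ugraph \<Rightarrow> bool" where
  "simple_graph G \<longleftrightarrow>
     finite (verts G) \<and> edges G \<subseteq> {{u, v} |u v. u \<in> verts G \<and> v \<in> verts G \<and> u \<noteq> v}"

definition degree :: "'a ugraph \<Rightarrow> 'a \<Rightarrow> nat" where
  "degree G v = card {e \<in> edges G. v \<in> e}"

text \<open>The parts of a bipartition may be empty.\<close>

definition bipartition :: "'a ugraph \<Rightarrow> 'a set \<Rightarrow> 'a set \<Rightarrow> bool" where
  "bipartition G X Y \<longleftrightarrow>
     verts G = X \<union> Y \<and> X \<inter> Y = {} \<and> (\<forall>e \<in> edges G. \<exists>x \<in> X. \<exists>y \<in> Y. e = {x, y})"

text \<open>\<open>contains_copy G H\<close>: \<open>G\<close> has a subgraph, not necessarily induced, isomorphic to \<open>H\<close>.\<close>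

definition contains_copy :: "'b ugraph \<Rightarrow> 'a ugraph \<Rightarrow> bool" where
  "contains_copy G H \<longleftrightarrow>
     (\<exists>f. inj_on f (verts H) \<and> f ` verts H \<subseteq> verts G \<and> (\<forall>e \<in> edges H. f ` e \<in> edges G))"

definition C4 :: "nat ugraph" where
  "C4 = ({0, 1, 2, 3}, {{0, 1}, {1, 2}, {2, 3}, {3, 0}})"

text \<open>
  Edge numbers and containment of copies are isomorphism invariant, so it suffices to let the
  \<open>n\<close>-vertex graphs range over those with vertex set \<open>{..<n}\<close>.  If every \<open>n\<close>-vertex graph
  contains \<open>H\<close> (possible only when \<open>H\<close> has no edges), the value is \<open>Sup {} = 0\<close>; otherwise it
  is a maximum, as shown below.
\<close>

definition extremal_number :: "nat \<Rightarrow> 'a ugraph \<Rightarrow> nat" where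
  "extremal_number n H =
     Sup {card (edges G) |G :: nat ugraph.
       simple_graph G \<and> verts G = {..<n} \<and> \<not> contains_copy G H}"

lemma finite_extremal_candidates:
  "finite {card (edges G) |G :: nat ugraph.
     simple_graph G \<and> verts G = {..<n} \<and> \<not> contains_copy G H}"
proof -
  have "{card (edges G) |G :: nat ugraph.
     simple_graph G \<and> verts G = {..<n} \<and> \<not> contains_copy G H} \<subseteq> card ` Pow (Pow {..<n})"
    by (fastforce simp: simple_graph_def)
  then show ?thesis
    by (rule finite_subset) simp
qed

lemma extremal_number_eq_Max:
  assumes "\<exists>G :: nat ugraph. simple_graph G \<and> verts G = {..<n} \<and> \<not> contains_copy G H"
  shows "extremal_number n H =
    Max {card (edges G) |G :: nat ugraph.
      simple_graph G \<and> verts G = {..<n} \<and> \<not> contains_copy G H}"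
  unfolding extremal_number_def
  by (rule cSup_eq_Max[OF finite_extremal_candidates]) (use assms in blast)

end

theory Submission
  imports Defs "HOL-Analysis.Convex"
begin

text \<open>
  The theorem follows once a graph without a large subdivided clique (pairs of branch vertices
  joined through distinct middle vertices) has few edges: \<open>H\<close> embeds into the subdivision, because
  the absence of \<open>C\<^sub>4\<close> makes the neighbourhoods of degree-two vertices of \<open>Y\<close> distinct.
  Call a pair of vertices heavy if it has at least \<open>t + t\<^sup>2\<close> common neighbours, and light if
  it has fewer but at least one. A clique of heavy pairs yields a subdivided \<open>K\<^sub>t\<close> greedily, so
  a positive proportion of the pairs inside every large neighbourhood are light, and a set \<open>U\<close>
  spans about \<open>(\<Sum>u\<in>U. deg u)\<^sup>2 / n\<close> light pairs. Applied to the vertices of degree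
  at least \<open>c \<surd>n\<close> this shows that they meet only \<open>O(n)\<close> edges, so they may be deleted. In what
  remains, sets of \<open>n\<^bsup>1-O(\<delta>)\<^esup>\<close> vertices of degree \<open>n\<^bsup>1/2-O(\<delta>)\<^esup>\<close>
  contain vertices with light-neighbourhoods of the same kind, and a clique of light pairs is built
  vertex by vertex. At each stage only \<open>O(\<surd>n)\<close> candidates would create a common neighbour of
  three chosen vertices; avoiding them makes the middle vertices distinct.
\<close>

section \<open>Cliques and distinct representatives\<close>

text \<open>A chosen \<open>u\<close> rules out its at most \<open>k\<close> partners under
  \<open>B\<close>, itself included by reflexivity, so \<open>t\<close> rounds consume at most
  \<open>k * t\<close> elements.\<close>

lemma exists_clique_greedy:
  assumes "finite N" and "sym B" and "\<And>u. u \<in> N \<Longrightarrow> (u, u) \<in> B"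
    and "\<And>u. u \<in> N \<Longrightarrow> card (N \<inter> B `` {u}) \<le> k"
    and "0 < k" and "k * t \<le> card N"
  shows "\<exists>S \<subseteq> N. card S = t \<and> (\<forall>u\<in>S. \<forall>v\<in>S. u \<noteq> v \<longrightarrow> (u, v) \<notin> B)"
  using assms
proof (induction t arbitrary: N)
  case 0
  show ?case by (intro exI[of _ "{}"]) simp
next
  case (Suc t)
  have "card N > 0" using Suc.prems(5,6) by (simp add: add_pos_nonneg)
  then obtain u where u: "u \<in> N" by (metis card_gt_0_iff ex_in_conv)
  let ?N = "N - B `` {u}"
  have fin: "finite S" if "S \<subseteq> N" for S
    using that Suc.prems(1) by (rule finite_subset)
  have "card ?N = card N - card (N \<inter> B `` {u})"
    by (rule card_Diff_subset_Int) (simp add: Suc.prems(1))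
  with Suc.prems(4)[OF u] Suc.prems(6) have "k * t \<le> card ?N" by simp
  moreover have "card (?N \<inter> B `` {v}) \<le> k" if "v \<in> ?N" for v
  proof -
    have "card (?N \<inter> B `` {v}) \<le> card (N \<inter> B `` {v})"
      using Suc.prems(1) by (intro card_mono) auto
    then show ?thesis using Suc.prems(4)[of v] that by force
  qed
  ultimately obtain S where S: "S \<subseteq> ?N" "card S = t"
    "\<forall>u\<in>S. \<forall>v\<in>S. u \<noteq> v \<longrightarrow> (u, v) \<notin> B"
    using Suc.IH[of ?N] Suc.prems by auto
  have "u \<notin> S" using S(1) Suc.prems(3)[OF u] by auto
  moreover have "(u, v) \<notin> B \<and> (v, u) \<notin> B" if "v \<in> S" for v
    using S(1) that \<open>sym B\<close> by (auto dest: symD)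
  moreover have "insert u S \<subseteq> N" using S(1) u by auto
  moreover have "card (insert u S) = Suc t"
    using S(1,2) \<open>u \<notin> S\<close> fin[of S] by (simp add: subset_iff)
  ultimately show ?case using S(3)
    by (intro exI[of _ "insert u S"]) auto
qed

text \<open>By Markov's inequality more than half of \<open>N\<close> has at most |N|/(2t) bad
  partners, and the greedy choice succeeds inside that half. The diagonal counts among the bad
  pairs.\<close>

lemma exists_clique_if_few_bad_pairs:
  assumes "finite N" and "sym B" and refl: "\<And>u. u \<in> N \<Longrightarrow> (u, u) \<in> B"
    and few: "4 * t * card (B \<inter> N \<times> N) < card N ^ 2"
  shows "\<exists>S \<subseteq> N. card S = t \<and> (\<forall>u\<in>S. \<forall>v\<in>S. u \<noteq> v \<longrightarrow> (u, v) \<notin> B)"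
proof (cases "t = 0")
  case True
  then show ?thesis by (intro exI[of _ "{}"]) simp
next
  case False
  let ?d = "card N"
  let ?deg = "\<lambda>u. card (N \<inter> B `` {u})"
  define L where "L = {u \<in> N. 2 * t * ?deg u \<le> ?d}"
  have cB: "card (B \<inter> N \<times> N) = (\<Sum>u\<in>N. ?deg u)"
  proof -
    have "B \<inter> N \<times> N = (SIGMA u:N. N \<inter> B `` {u})" by auto
    then show ?thesis using \<open>finite N\<close> by (simp add: card_SigmaI)
  qed
  \<comment> \<open>The diagonal contributes |N| bad pairs, which forces |N| > 4t and keeps the
    rounded quotient \<open>?k\<close> below positive.\<close>
  have "?d = (\<Sum>u\<in>N. 1)" by simp
  also have "\<dots> \<le> card (B \<inter> N \<times> N)"
    unfolding cB
  proof (rule sum_mono)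
    fix u assume "u \<in> N"
    then have "N \<inter> B `` {u} \<noteq> {}" using refl by auto
    then show "1 \<le> ?deg u" using \<open>finite N\<close> by (simp add: Suc_le_eq card_gt_0_iff)
  qed
  finally have "4 * t * ?d < ?d ^ 2"
    using few by (meson le_less_trans mult_le_mono2)
  then have "4 * t < ?d" by (simp add: power2_eq_square)
  have "card (N - L) * ?d = (\<Sum>u\<in>N-L. ?d)" by simp
  also have "\<dots> \<le> (\<Sum>u\<in>N-L. 2 * t * ?deg u)"
    by (rule sum_mono) (auto simp: L_def)
  also have "\<dots> \<le> (\<Sum>u\<in>N. 2 * t * ?deg u)"
    using \<open>finite N\<close> by (intro sum_mono2) auto
  also have "\<dots> = 2 * t * card (B \<inter> N \<times> N)" by (simp add: cB sum_distrib_left)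
  finally have "(2 * card (N - L)) * ?d < ?d * ?d"
    using few unfolding power2_eq_square by linarith
  then have "2 * card (N - L) < ?d" by (metis mult_less_cancel2)
  moreover have "card (N - L) = ?d - card L" "card L \<le> ?d"
    using \<open>finite N\<close> by (auto simp: L_def card_Diff_subset intro: card_mono)
  ultimately have L: "?d < 2 * card L" by linarith
  \<comment> \<open>Rounding down is harmless: degrees are integers, so those of members of
    \<open>L\<close> are still at most \<open>?k\<close>, while \<open>?k * t\<close> is at most
    half of |N|.\<close>
  let ?k = "?d div (2 * t)"
  have "?k * (2 * t) \<le> ?d" by simp
  then have "?k * t \<le> card L" using L by linarith
  moreover have "0 < ?k" using \<open>4 * t < ?d\<close> False by (simp add: div_greater_zero_iff)
  moreover have "card (L \<inter> B `` {u}) \<le> ?k" if "u \<in> L" for u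
  proof -
    have "card (L \<inter> B `` {u}) \<le> ?deg u"
      using \<open>finite N\<close> by (intro card_mono) (auto simp: L_def)
    also have "\<dots> \<le> ?k" using that False
      by (simp add: L_def less_eq_div_iff_mult_less_eq mult.commute)
    finally show ?thesis .
  qed
  moreover have "L \<subseteq> N" "finite L" using \<open>finite N\<close> by (auto simp: L_def)
  ultimately show ?thesis
    using exists_clique_greedy[of L B ?k t] assms(2) refl by blast
qed

text \<open>Greedy choice: at every stage the values already used and those in \<open>Z\<close> are
  together fewer than the candidates.\<close>

lemma exists_distinct_representatives:
  assumes "finite I" and "finite Z"
    and "\<And>i. i \<in> I \<Longrightarrow> card I + card Z \<le> card (F i)"
  shows "\<exists>w. inj_on w I \<and> (\<forall>i\<in>I. w i \<in> F i - Z)"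
  using assms(1,3)
proof (induction I)
  case empty
  show ?case by simp
next
  case (insert i I)
  then obtain w where w: "inj_on w I" "\<forall>j\<in>I. w j \<in> F j - Z"
    by force
  have "card (w ` I \<union> Z) \<le> card I + card Z"
    by (meson card_Un_le card_image_le insert.hyps(1) le_trans add_le_mono1)
  also have "\<dots> < card (F i)" using insert.prems[of i] insert.hyps by simp
  finally have "\<not> F i \<subseteq> w ` I \<union> Z"
    using insert.hyps(1) \<open>finite Z\<close> by (meson card_mono finite_UnI finite_imageI leD)
  then obtain x where x: "x \<in> F i" "x \<notin> w ` I" "x \<notin> Z" by auto
  have "inj_on (w(i := x)) (insert i I)"
    using w(1) x insert.hyps by (auto simp: inj_on_def)
  then show ?case using w(2) x insert.hyps by (intro exI[of _ "w(i := x)"]) (simp del: fun_upd_apply, auto)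
qed

section \<open>Subdivided cliques and light pairs\<close>

text \<open>\<open>w\<close> takes the unordered pair, so the instances for (u, v) and (v, u) speak
  of the same middle vertex and give both halves of the subdivided edge.\<close>

definition subdivided_clique :: "'a rel \<Rightarrow> 'a set \<Rightarrow> ('a set \<Rightarrow> 'a) \<Rightarrow> bool" where
  "subdivided_clique R S w \<longleftrightarrow>
     inj_on w {{u, v} |u v. u \<in> S \<and> v \<in> S \<and> u \<noteq> v} \<and>
     (\<forall>u\<in>S. \<forall>v\<in>S. u \<noteq> v \<longrightarrow> (u, w {u, v}) \<in> R \<and> w {u, v} \<notin> S)"

definition has_subdivided_clique :: "nat \<Rightarrow> 'a rel \<Rightarrow> bool" where
  "has_subdivided_clique t R \<longleftrightarrow> (\<exists>S w. finite S \<and> card S = t \<and> subdivided_clique R S w)"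

lemma has_subdivided_clique_mono:
  "has_subdivided_clique t R \<Longrightarrow> R \<subseteq> R' \<Longrightarrow> has_subdivided_clique t R'"
  unfolding has_subdivided_clique_def subdivided_clique_def by blast

definition common_nbrs :: "'a rel \<Rightarrow> 'a \<Rightarrow> 'a \<Rightarrow> 'a set" where
  "common_nbrs R u v = R `` {u} \<inter> R `` {v}"

lemma common_nbrs_commute: "common_nbrs R u v = common_nbrs R v u"
  by (auto simp: common_nbrs_def)

text \<open>At most t^2 pairs need a middle vertex and the t vertices of \<open>S\<close> are
  forbidden, so t + t^2 common neighbours leave room for distinct choices.\<close>

lemma has_subdivided_clique_if_heavy_clique:
  assumes "finite S" and "card S = t"
    and heavy: "\<And>u v. u \<in> S \<Longrightarrow> v \<in> S \<Longrightarrow> u \<noteq> v \<Longrightarrow> t + t\<^sup>2 \<le> card (common_nbrs R u v)"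
  shows "has_subdivided_clique t R"
proof -
  let ?I = "{{u, v} |u v. u \<in> S \<and> v \<in> S \<and> u \<noteq> v}"
  have I: "?I \<subseteq> (\<lambda>(u, v). {u, v}) ` (S \<times> S)" by auto
  have fI: "finite ?I"
    by (rule finite_subset[OF I]) (simp add: assms)
  have "card ?I \<le> card (S \<times> S)"
    using assms(1) I by (intro surj_card_le) auto
  then have cI: "card ?I + card S \<le> t + t\<^sup>2"
    using assms(2) by (simp add: power2_eq_square card_cartesian_product)
  have "\<exists>w. inj_on w ?I \<and> (\<forall>i\<in>?I. w i \<in> (\<Inter>u\<in>i. R `` {u}) - S)"
  proof (rule exists_distinct_representatives[OF fI assms(1)])
    fix i assume "i \<in> ?I"
    then obtain u v where uv: "i = {u, v}" "u \<in> S" "v \<in> S" "u \<noteq> v" by auto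
    then have "(\<Inter>u\<in>i. R `` {u}) = common_nbrs R u v" by (auto simp: common_nbrs_def)
    then show "card ?I + card S \<le> card (\<Inter>u\<in>i. R `` {u})"
      using heavy[OF uv(2-4)] cI by simp
  qed
  then obtain w where w: "inj_on w ?I" "\<forall>i\<in>?I. w i \<in> (\<Inter>u\<in>i. R `` {u}) - S" by blast
  have "(u, w {u, v}) \<in> R \<and> w {u, v} \<notin> S" if "u \<in> S" "v \<in> S" "u \<noteq> v" for u v
  proof -
    have "{u, v} \<in> ?I" using that by blast
    with w(2) have "w {u, v} \<in> (\<Inter>x\<in>{u, v}. R `` {x}) - S" by blast
    then show ?thesis by auto
  qed
  then have "subdivided_clique R S w"
    using w(1) by (auto simp: subdivided_clique_def)
  then show ?thesis using assms(1,2) by (auto simp: has_subdivided_clique_def)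
qed


section \<open>Light pairs in finite symmetric relations\<close>

locale finite_sym_rel =
  fixes V :: "'a set" and R :: "'a rel"
  assumes finite_V: "finite V" and R_subset: "R \<subseteq> V \<times> V"
    and sym_R: "sym R" and irrefl_R: "irrefl R"
begin

lemma R_sym: "(u, v) \<in> R \<Longrightarrow> (v, u) \<in> R"
  using sym_R by (rule symD)

lemma R_irrefl: "(u, u) \<notin> R"
  using irrefl_R by (simp add: irrefl_def)

lemma nbrs_subset: "R `` A \<subseteq> V"
  using R_subset by auto

lemma finite_nbrs: "finite (R `` A)"
  using nbrs_subset finite_V by (rule finite_subset)

definition deg_sum :: "'a set \<Rightarrow> nat" where
  "deg_sum U = (\<Sum>u\<in>U. card (R `` {u}))"

lemma deg_sum_V: "deg_sum V = card R"
proof -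
  have "R = (SIGMA u:V. R `` {u})" using R_subset by auto
  then have "card R = card (SIGMA u:V. R `` {u})" by simp
  then show ?thesis
    using finite_V finite_nbrs by (simp add: deg_sum_def)
qed

lemma deg_sum_double_count:
  assumes "U \<subseteq> V"
  shows "deg_sum U = (\<Sum>b\<in>V. card (R `` {b} \<inter> U))"
proof -
  have fU: "finite U" using assms finite_V by (rule finite_subset)
  have "(\<Sum>u\<in>U. card {b\<in>V. (u, b) \<in> R}) = (\<Sum>b\<in>V. card {u\<in>U. (u, b) \<in> R})"
    by (rule sum_multicount_gen) (auto simp: fU finite_V)
  moreover have "{b\<in>V. (u, b) \<in> R} = R `` {u}" for u using R_subset by auto
  moreover have "{u\<in>U. (u, b) \<in> R} = R `` {b} \<inter> U" for b using R_sym by auto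
  ultimately show ?thesis by (simp add: deg_sum_def)
qed

text \<open>Nonemptiness supplies a middle vertex for the pair; the bound by \<open>T\<close> limits
  how often the pair is double counted and how many later candidates it can spoil.\<close>

definition light :: "nat \<Rightarrow> 'a rel" where
  "light T = {(u, v). u \<noteq> v \<and> common_nbrs R u v \<noteq> {} \<and> card (common_nbrs R u v) < T}"

lemma sym_light: "sym (light T)"
  by (auto simp: light_def common_nbrs_commute intro!: symI)

text \<open>Any two vertices of \<open>N b\<close>, the neighbours of \<open>b\<close> in
  \<open>U\<close>, share the neighbour \<open>b\<close>, so they are light or heavy. As no
  \<open>t\<close> of them are pairwise heavy, a positive proportion of the pairs in
  \<open>N b\<close> is light or diagonal. Summing over \<open>b\<close> and applying Cauchy-Schwarz
  gives the bound.\<close>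

lemma deg_sum_square_le:
  assumes no: "\<not> has_subdivided_clique t R" and "U \<subseteq> V"
  defines "T \<equiv> t + t\<^sup>2"
  shows "(deg_sum U)\<^sup>2 \<le> 4 * t * card V * (deg_sum U + T * card (light T \<inter> U \<times> U))"
proof -
  have fU: "finite U" using assms(2) finite_V by (rule finite_subset)
  define N where "N b = R `` {b} \<inter> U" for b
  define P where "P = light T \<inter> U \<times> U"
  have fN: "finite (N b)" for b using fU by (simp add: N_def)
  have fP: "finite P" using fU by (simp add: P_def)
  have per_vertex: "(card (N b))\<^sup>2 \<le> 4 * t * (card (N b) + card (P \<inter> N b \<times> N b))" for b
  proof (rule ccontr)
    assume less: "\<not> ?thesis"
    \<comment> \<open>Adding \<open>Id\<close> makes the bad relation reflexive, as the clique lemma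
      demands; the diagonal costs the summand \<open>card (N b)\<close>.\<close>
    have "(Id \<union> light T) \<inter> N b \<times> N b \<subseteq> (\<lambda>u. (u, u)) ` N b \<union> (P \<inter> N b \<times> N b)"
      by (auto simp: P_def N_def)
    then have "card ((Id \<union> light T) \<inter> N b \<times> N b) \<le> card ((\<lambda>u. (u, u)) ` N b \<union> (P \<inter> N b \<times> N b))"
      using fN by (intro card_mono) auto
    also have "\<dots> \<le> card ((\<lambda>u. (u, u)) ` N b) + card (P \<inter> N b \<times> N b)"
      by (rule card_Un_le)
    also have "\<dots> \<le> card (N b) + card (P \<inter> N b \<times> N b)"
      using fN[of b] by (simp add: card_image_le)
    finally have "4 * t * card ((Id \<union> light T) \<inter> N b \<times> N b) < (card (N b))\<^sup>2"
      using less by (meson leI le_less_trans mult_le_mono2)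
    moreover have "sym (Id \<union> light T)" by (simp add: sym_light sym_Un sym_Id)
    ultimately obtain S where S: "S \<subseteq> N b" "card S = t"
      "\<forall>u\<in>S. \<forall>v\<in>S. u \<noteq> v \<longrightarrow> (u, v) \<notin> Id \<union> light T"
      using exists_clique_if_few_bad_pairs[OF fN[of b], of "Id \<union> light T" t] by auto
    have "T \<le> card (common_nbrs R u v)" if "u \<in> S" "v \<in> S" "u \<noteq> v" for u v
    proof -
      have "(b, u) \<in> R" "(b, v) \<in> R" using that S(1) by (auto simp: N_def)
      then have "b \<in> common_nbrs R u v" by (auto simp: common_nbrs_def dest: R_sym)
      moreover have "(u, v) \<notin> light T" using S(3) that by blast
      ultimately show ?thesis using that by (auto simp: light_def)
    qed
    then have "has_subdivided_clique t R"
      using S(1,2) fN[of b] unfolding T_def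
      by (intro has_subdivided_clique_if_heavy_clique[of S]) (auto intro: finite_subset)
    with no show False by simp
  qed
  \<comment> \<open>Double counting: a light pair lies in \<open>N b\<close> only when
    \<open>b\<close> is one of its common neighbours, hence for at most \<open>T\<close> vertices
    \<open>b\<close>.\<close>
  have "(\<Sum>b\<in>V. card (P \<inter> N b \<times> N b)) = (\<Sum>b\<in>V. card {p\<in>P. p \<in> N b \<times> N b})"
    by (intro sum.cong arg_cong[of _ _ card]) auto
  also have "\<dots> = (\<Sum>p\<in>P. card {b\<in>V. p \<in> N b \<times> N b})"
    by (rule sum_multicount_gen) (auto simp: fP finite_V)
  also have "\<dots> \<le> (\<Sum>p\<in>P. T)"
  proof (rule sum_mono)
    fix p assume "p \<in> P"
    then obtain u v where p: "p = (u, v)" "(u, v) \<in> light T" by (auto simp: P_def)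
    have "card {b\<in>V. p \<in> N b \<times> N b} \<le> card (common_nbrs R u v)"
      by (rule card_mono) (auto simp: p common_nbrs_def N_def finite_nbrs dest: R_sym)
    also have "\<dots> \<le> T" using p(2) by (simp add: light_def)
    finally show "card {b\<in>V. p \<in> N b \<times> N b} \<le> T" .
  qed
  finally have light_sum: "(\<Sum>b\<in>V. card (P \<inter> N b \<times> N b)) \<le> T * card P"
    by (simp add: mult.commute)
  have E: "deg_sum U = (\<Sum>b\<in>V. card (N b))"
    using deg_sum_double_count[OF assms(2)] by (simp add: N_def)
  \<comment> \<open>Cauchy-Schwarz over \<open>V\<close>, carried out in the reals.\<close>
  have "real ((deg_sum U)\<^sup>2) \<le> real (card V * (\<Sum>b\<in>V. (card (N b))\<^sup>2))"
    using sum_squared_le_sum_of_squares[of "\<lambda>b. real (card (N b))" V]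
    by (simp add: E mult.commute)
  then have "(deg_sum U)\<^sup>2 \<le> card V * (\<Sum>b\<in>V. (card (N b))\<^sup>2)"
    by (simp only: of_nat_le_iff)
  also have "(\<Sum>b\<in>V. (card (N b))\<^sup>2) \<le> (\<Sum>b\<in>V. 4 * t * (card (N b) + card (P \<inter> N b \<times> N b)))"
    by (rule sum_mono) (rule per_vertex)
  also have "\<dots> = 4 * t * (deg_sum U + (\<Sum>b\<in>V. card (P \<inter> N b \<times> N b)))"
    by (simp only: E sum.distrib flip: sum_distrib_left)
  also have "\<dots> \<le> 4 * t * (deg_sum U + T * card P)"
    using light_sum by (intro mult_le_mono2 add_left_mono)
  finally show ?thesis by (simp add: P_def algebra_simps)
qed

text \<open>If the degree sum E exceeded 8t|V|, the linear term of \<open>deg_sum_square_le\<close>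
  would be at most half of E^2. Bounding the light pairs by |U|^2 then gives E^2 \<le> 8tT|V||U|^2,
  which contradicts E \<ge> M|U| and the choice of \<open>M\<close>.\<close>

lemma deg_sum_high_degree_le:
  fixes M :: real
  assumes no: "\<not> has_subdivided_clique t R"
    and M: "8 * t * (t + t\<^sup>2) * card V < M\<^sup>2" "0 \<le> M"
  shows "deg_sum {v \<in> V. M \<le> real (card (R `` {v}))} \<le> 8 * t * card V"
proof (rule ccontr)
  define U where "U = {v \<in> V. M \<le> real (card (R `` {v}))}"
  define T where "T = t + t\<^sup>2"
  define E where "E = deg_sum U"
  assume "\<not> ?thesis"
  then have big: "8 * t * card V < E" by (simp add: U_def E_def)
  have U: "U \<subseteq> V" "finite U" using finite_V by (auto simp: U_def)
  have "card (light T \<inter> U \<times> U) \<le> card (U \<times> U)"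
    using U(2) by (intro card_mono) auto
  then have "4 * t * card V * (E + T * card (light T \<inter> U \<times> U)) \<le> 4 * t * card V * (E + T * (card U)\<^sup>2)"
    by (intro mult_le_mono2 add_left_mono) (simp add: card_cartesian_product power2_eq_square)
  then have 1: "E\<^sup>2 \<le> 4 * t * card V * (E + T * (card U)\<^sup>2)"
    using deg_sum_square_le[OF no U(1)] unfolding E_def T_def by linarith
  have "(8 * t * card V) * E \<le> E * E" using big by (intro mult_le_mono1) simp
  then have "2 * (4 * t * card V * E) \<le> E\<^sup>2" by (simp add: power2_eq_square mult.assoc)
  then have "E\<^sup>2 \<le> 2 * (4 * t * card V * (T * (card U)\<^sup>2))"
    using 1 unfolding distrib_left by linarith
  then have "E\<^sup>2 \<le> 8 * t * card V * (T * (card U)\<^sup>2)" by simp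
  then have "real (E\<^sup>2) \<le> real (8 * t * card V * (T * (card U)\<^sup>2))" by (simp only: of_nat_le_iff)
  also have "\<dots> = (8 * t * T * card V) * (real (card U))\<^sup>2" by (simp add: algebra_simps)
  finally have upper: "real E ^ 2 \<le> (8 * t * T * card V) * (real (card U))\<^sup>2" by simp
  have "M * card U \<le> E"
  proof -
    have "M * card U = (\<Sum>u\<in>U. M)" by simp
    also have "\<dots> \<le> (\<Sum>u\<in>U. real (card (R `` {u})))" by (rule sum_mono) (simp add: U_def)
    finally show ?thesis by (simp add: E_def deg_sum_def)
  qed
  then have "M\<^sup>2 * (real (card U))\<^sup>2 \<le> (real E)\<^sup>2"
    using M(2) by (metis of_nat_0_le_iff power_mono power_mult_distrib mult_nonneg_nonneg)
  moreover have "U \<noteq> {}" using big by (auto simp: E_def deg_sum_def)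
  then have "0 < (real (card U))\<^sup>2" using U(2) by (simp add: card_gt_0_iff)
  then have "(8 * t * T * card V) * (real (card U))\<^sup>2 < M\<^sup>2 * (real (card U))\<^sup>2"
    using M(1) unfolding T_def by (intro mult_strict_right_mono) auto
  ultimately show False using upper by linarith
qed

end

section \<open>Cliques of light pairs\<close>

text \<open>
  Choosing one vertex replaces a density \<open>s\<close> by \<open>s ^ 4 / (16 * t * (t + t\<^sup>2))\<close>; a density
  \<open>s\<close> with \<open>s ^ ext_exponent k * sqrt n \<ge> ext_threshold t c k\<close> survives \<open>k\<close> such steps.
\<close>

primrec ext_exponent :: "nat \<Rightarrow> nat" where
  "ext_exponent 0 = 1"
| "ext_exponent (Suc k) = 4 * ext_exponent k + 4"

primrec ext_threshold :: "nat \<Rightarrow> real \<Rightarrow> nat \<Rightarrow> real" where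
  "ext_threshold t c 0 = 1"
| "ext_threshold t c (Suc k) =
     ext_threshold t c k * (16 * t * (t + t\<^sup>2)) ^ ext_exponent k +
     8 * t + 16 * t * (t + t\<^sup>2) * (1 + t * (t + t\<^sup>2)) * c"

lemma ext_exponent_pos: "0 < ext_exponent k"
  by (cases k) auto

lemma ext_threshold_ge_1:
  assumes "0 < t" and "0 \<le> c"
  shows "1 \<le> ext_threshold t c k"
proof (induction k)
  case (Suc k)
  define d where "d = real (16 * t * (t + t\<^sup>2))"
  have "1 \<le> 16 * t * (t + t\<^sup>2)" using \<open>0 < t\<close> by simp
  then have "1 \<le> d" unfolding d_def by linarith
  then have "1 * 1 \<le> ext_threshold t c k * d ^ ext_exponent k"
    using Suc by (intro mult_mono one_le_power) auto
  moreover have "0 \<le> 8 * t + d * (1 + t * (t + t\<^sup>2)) * c"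
    using \<open>1 \<le> d\<close> \<open>0 \<le> c\<close> by (intro add_nonneg_nonneg mult_nonneg_nonneg) auto
  ultimately show ?case by (simp add: d_def)
qed simp

context finite_sym_rel
begin

text \<open>Non-adjacency keeps common neighbours of a pair out of \<open>S\<close>; the condition
  on triples makes the common neighbourhoods of different pairs disjoint.\<close>

definition light_clique :: "nat \<Rightarrow> 'a set \<Rightarrow> bool" where
  "light_clique T S \<longleftrightarrow>
     (\<forall>u\<in>S. \<forall>v\<in>S. u \<noteq> v \<longrightarrow> (u, v) \<in> light T \<and> (u, v) \<notin> R) \<and>
     (\<forall>u\<in>S. \<forall>v\<in>S. \<forall>x\<in>S. u \<noteq> v \<longrightarrow> u \<noteq> x \<longrightarrow> v \<noteq> x \<longrightarrow> R `` {u} \<inter> R `` {v} \<inter> R `` {x} = {})"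

lemma light_clique_no_common_nbr:
  assumes "light_clique T S" and "a \<in> S" "b \<in> S" "c \<in> S" and "a \<noteq> b" "a \<noteq> c" "b \<noteq> c"
  shows "R `` {a} \<inter> R `` {b} \<inter> R `` {c} = {}"
  using assms by (simp add: light_clique_def)

text \<open>Pairs and triples missing \<open>u\<close> or \<open>v\<close> lie in one of the two
  given cliques; only the pair u, v and the triples u, v, x with x in \<open>S\<close> are
  new.\<close>

lemma light_clique_insert2:
  assumes u: "light_clique T (insert u S)" and v: "light_clique T (insert v S)"
    and "(u, v) \<in> light T" and "(u, v) \<notin> R"
    and triple: "\<And>x. x \<in> S \<Longrightarrow> common_nbrs R u x \<inter> R `` {v} = {}"
  shows "light_clique T (insert v (insert u S))"
proof -
  have sym: "(v, u) \<in> light T" "(v, u) \<notin> R"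
    using assms(3,4) sym_light R_sym by (auto dest: symD)
  have "R `` {a} \<inter> R `` {b} \<inter> R `` {c} = {}"
    if abc: "a \<in> insert v (insert u S)" "b \<in> insert v (insert u S)" "c \<in> insert v (insert u S)"
      "a \<noteq> b" "a \<noteq> c" "b \<noteq> c" for a b c
  proof -
    consider "{a, b, c} \<subseteq> insert u S" | "{a, b, c} \<subseteq> insert v S"
      | x where "x \<in> S" "{a, b, c} = {u, v, x}"
      using abc by blast
    then show ?thesis
    proof cases
      case 1
      then have "a \<in> insert u S" "b \<in> insert u S" "c \<in> insert u S" by auto
      with u show ?thesis using that(4-6) by (rule light_clique_no_common_nbr)
    next
      case 2
      then have "a \<in> insert v S" "b \<in> insert v S" "c \<in> insert v S" by auto
      with v show ?thesis using that(4-6) by (rule light_clique_no_common_nbr)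
    next
      case 3
      have "R `` {a} \<inter> R `` {b} \<inter> R `` {c} = (\<Inter>y\<in>{a, b, c}. R `` {y})" by auto
      also have "\<dots> = common_nbrs R u x \<inter> R `` {v}" by (auto simp: 3(2) common_nbrs_def)
      finally show ?thesis using triple[OF 3(1)] by simp
    qed
  qed
  moreover have "(a, b) \<in> light T \<and> (a, b) \<notin> R"
    if "a \<in> insert v (insert u S)" "b \<in> insert v (insert u S)" "a \<noteq> b" for a b
    using that u v assms(3,4) sym by (auto simp: light_clique_def)
  ultimately show ?thesis by (simp only: light_clique_def) simp
qed

text \<open>Any choice of common neighbours works: a middle vertex shared by two pairs would have
  three neighbours in \<open>S\<close>, and one inside \<open>S\<close> would be adjacent to a
  member of \<open>S\<close>.\<close>

lemma has_subdivided_clique_if_light_clique: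
  assumes "light_clique T S" and "finite S" and "card S = t"
  shows "has_subdivided_clique t R"
proof -
  define w where "w i = (SOME b. \<forall>u\<in>i. (u, b) \<in> R)" for i
  have w: "(u, w {u, v}) \<in> R \<and> (v, w {u, v}) \<in> R" if "u \<in> S" "v \<in> S" "u \<noteq> v" for u v
  proof -
    have "common_nbrs R u v \<noteq> {}"
      using assms(1) that by (auto simp: light_clique_def light_def)
    then have "\<exists>b. \<forall>x\<in>{u, v}. (x, b) \<in> R" by (auto simp: common_nbrs_def)
    then have "\<forall>x\<in>{u, v}. (x, w {u, v}) \<in> R" unfolding w_def by (rule someI_ex)
    then show ?thesis by simp
  qed
  have "w {u, v} \<notin> S" if "u \<in> S" "v \<in> S" "u \<noteq> v" for u v
    using w[OF that] assms(1) that R_irrefl unfolding light_clique_def by metis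
  moreover have "inj_on w {{u, v} |u v. u \<in> S \<and> v \<in> S \<and> u \<noteq> v}"
  proof (rule inj_onI, rule ccontr)
    fix i j assume "i \<in> {{u, v} |u v. u \<in> S \<and> v \<in> S \<and> u \<noteq> v}"
      "j \<in> {{u, v} |u v. u \<in> S \<and> v \<in> S \<and> u \<noteq> v}" and eq: "w i = w j" and "i \<noteq> j"
    then obtain u v u' v' where i: "i = {u, v}" "u \<in> S" "v \<in> S" "u \<noteq> v"
      and j: "j = {u', v'}" "u' \<in> S" "v' \<in> S" "u' \<noteq> v'" by auto
    \<comment> \<open>Two different two-element sets span at least three vertices; \<open>x\<close>
      is one of \<open>j\<close> outside \<open>i\<close>.\<close>
    then obtain x where x: "x \<in> S" "x \<in> j" "x \<noteq> u" "x \<noteq> v" using \<open>i \<noteq> j\<close> by auto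
    have "(x, w i) \<in> R" using x(2) w[OF j(2-4)] by (auto simp: eq j(1))
    then have "w i \<in> R `` {u} \<inter> R `` {v} \<inter> R `` {x}"
      using w[OF i(2-4)] by (auto simp: i(1))
    then show False using assms(1) i x unfolding light_clique_def by blast
  qed
  ultimately have "subdivided_clique R S w"
    using w by (simp add: subdivided_clique_def)
  then show ?thesis using assms(2,3) by (auto simp: has_subdivided_clique_def)
qed

text \<open>\<open>U\<close> holds the candidates that extend \<open>S\<close>. It spans so many
  light pairs that some \<open>u\<close> in \<open>U\<close> has many light partners in
  \<open>U\<close>. Discarding those that are adjacent to \<open>u\<close> or create a common
  neighbour of three chosen vertices leaves the candidates \<open>U'\<close> for the extended
  clique.\<close>

lemma light_clique_step:
  fixes s c :: real and t :: nat
  defines "T \<equiv> t + t\<^sup>2"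
  assumes no: "\<not> has_subdivided_clique t R" and "0 < t" and "V \<noteq> {}"
    and max_deg: "\<And>v. v \<in> V \<Longrightarrow> card (R `` {v}) \<le> c * sqrt (card V)"
    and "U \<subseteq> V" and "0 < s"
    and U: "s * card V \<le> card U" and deg_U: "\<And>u. u \<in> U \<Longrightarrow> s * sqrt (card V) \<le> card (R `` {u})"
    and "finite S" and "card S \<le> t"
    and S: "\<And>u. u \<in> U \<Longrightarrow> u \<notin> S \<and> light_clique T (insert u S)"
    and large1: "8 * t \<le> s\<^sup>2 * sqrt (card V)"
    and large2: "16 * t * T * (1 + t * T) * c \<le> s ^ 4 * sqrt (card V)"
  shows "\<exists>u\<in>U. \<exists>U'\<subseteq>U. s ^ 4 / (16 * t * T) * card V \<le> card U' \<and>
    (\<forall>v\<in>U'. v \<notin> insert u S \<and> light_clique T (insert v (insert u S)))"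
proof -
  define n where "n = real (card V)"
  have "0 < n" using \<open>V \<noteq> {}\<close> finite_V by (simp add: n_def card_gt_0_iff)
  have "0 < T" using \<open>0 < t\<close> by (simp add: T_def)
  have fU: "finite U" using \<open>U \<subseteq> V\<close> finite_V by (rule finite_subset)
  define E where "E = real (deg_sum U)"
  define P where "P = real (card (light T \<inter> U \<times> U))"
  have sqrt_n: "sqrt n * sqrt n = n" using \<open>0 < n\<close> by simp
  have "s * n * (s * sqrt n) \<le> card U * (s * sqrt n)"
    using U \<open>0 < s\<close> \<open>0 < n\<close> by (intro mult_right_mono) (auto simp: n_def)
  also have "\<dots> = (\<Sum>u\<in>U. s * sqrt n)" by simp
  also have "\<dots> \<le> (\<Sum>u\<in>U. real (card (R `` {u})))"
    by (rule sum_mono) (use deg_U in \<open>simp add: n_def\<close>)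
  finally have E: "s\<^sup>2 * n * sqrt n \<le> E" by (simp add: E_def deg_sum_def power2_eq_square mult_ac)
  \<comment> \<open>\<open>large1\<close> serves to make the linear term of
    \<open>deg_sum_square_le\<close> at most half of E^2.\<close>
  have "8 * t * n \<le> s\<^sup>2 * sqrt n * n"
    using large1 \<open>0 < n\<close> unfolding n_def[symmetric] by (intro mult_right_mono) auto
  with E have E2: "8 * t * n \<le> E" by (simp add: mult_ac)
  have "real ((deg_sum U)\<^sup>2) \<le> real (4 * t * card V * (deg_sum U + T * card (light T \<inter> U \<times> U)))"
    using deg_sum_square_le[OF no \<open>U \<subseteq> V\<close>] unfolding T_def of_nat_le_iff .
  then have "E\<^sup>2 \<le> 4 * t * n * (E + T * P)" by (simp add: E_def P_def n_def)
  moreover have "8 * t * n * E \<le> E * E" using E2 by (intro mult_right_mono) (auto simp: E_def)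
  ultimately have "E\<^sup>2 \<le> 8 * t * T * n * P" by (simp add: power2_eq_square algebra_simps)
  moreover have "(s\<^sup>2 * n * sqrt n)\<^sup>2 \<le> E\<^sup>2"
    using E \<open>0 < n\<close> by (intro power_mono) auto
  moreover have "(s\<^sup>2 * n * sqrt n)\<^sup>2 = s ^ 4 * n * n * n"
    using \<open>0 < n\<close> by (simp add: power_mult_distrib power2_eq_square power4_eq_xxxx mult_ac)
  ultimately have "(s ^ 4 * n * n) * n \<le> (8 * t * T * P) * n" by (simp add: mult_ac)
  then have P: "s ^ 4 * n * n \<le> 8 * t * T * P" using \<open>0 < n\<close> by (simp only: mult_le_cancel_right_pos)
  \<comment> \<open>\<open>q\<close> is the new density. There are 2qn^2 light pairs, so averaging
    yields a vertex with 2qn light partners; up to half of these may be lost to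
    \<open>Bad\<close>.\<close>
  define q where "q = s ^ 4 / (16 * t * T)"
  have q: "0 < q" "s ^ 4 = 16 * t * T * q" using \<open>0 < s\<close> \<open>0 < t\<close> \<open>0 < T\<close> by (auto simp: q_def)
  have "(8 * t * T) * (2 * q * n * n) \<le> (8 * t * T) * P" using P by (simp add: q(2) mult_ac)
  then have P': "2 * q * n * n \<le> P"
    using \<open>0 < t\<close> \<open>0 < T\<close> by (simp only: mult_le_cancel_left) auto
  have P_sum: "P = (\<Sum>u\<in>U. real (card (light T `` {u} \<inter> U)))"
  proof -
    have "light T \<inter> U \<times> U = (SIGMA u:U. light T `` {u} \<inter> U)" by auto
    then have "card (light T \<inter> U \<times> U) = card (SIGMA u:U. light T `` {u} \<inter> U)" by simp
    then show ?thesis using fU by (simp add: P_def)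
  qed
  have "0 < s * card V" using \<open>0 < s\<close> \<open>0 < n\<close> by (simp add: n_def)
  then have "0 < card U" using U by linarith
  have "card U \<le> n" using \<open>U \<subseteq> V\<close> finite_V by (simp add: n_def card_mono)
  have "\<exists>u\<in>U. 2 * q * n \<le> card (light T `` {u} \<inter> U)"
  proof (rule ccontr)
    assume "\<not> ?thesis"
    then have "P < (\<Sum>u\<in>U. 2 * q * n)"
      unfolding P_sum using \<open>0 < card U\<close> fU by (intro sum_strict_mono) (auto simp: not_le)
    also have "\<dots> \<le> n * (2 * q * n)"
      using \<open>card U \<le> n\<close> q(1) \<open>0 < n\<close> by simp
    finally show False using P' by (simp add: mult_ac)
  qed
  then obtain u where u: "u \<in> U" "2 * q * n \<le> card (light T `` {u} \<inter> U)" by blast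
  \<comment> \<open>The sign of \<open>c\<close> is not assumed; it is read off from the degree
    bound at \<open>u\<close>.\<close>
  have cn: "0 \<le> c * sqrt n"
  proof -
    have "0 \<le> real (card (R `` {u}))" by simp
    also have "\<dots> \<le> c * sqrt n" using max_deg[of u] u(1) \<open>U \<subseteq> V\<close> by (auto simp: n_def)
    finally show ?thesis .
  qed
  \<comment> \<open>The second part collects every vertex sharing a common neighbour with
    \<open>u\<close> and some x in \<open>S\<close>. Since (u, x) is light, each x contributes fewer
    than \<open>T\<close> neighbourhoods of size at most c sqrt(n).\<close>
  define Bad where "Bad = R `` {u} \<union> (\<Union>x\<in>S. \<Union>w\<in>common_nbrs R u x. R `` {w})"
  have fcn: "finite (common_nbrs R u x)" for x by (simp add: common_nbrs_def finite_nbrs)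
  have union2: "real (card (\<Union>w\<in>common_nbrs R u x. R `` {w})) \<le> T * (c * sqrt n)" if "x \<in> S" for x
  proof -
    have "(u, x) \<in> light T" using S[OF u(1)] that by (auto simp: light_clique_def)
    then have le: "card (common_nbrs R u x) \<le> T" by (simp add: light_def)
    have "real (card (\<Union>w\<in>common_nbrs R u x. R `` {w})) \<le> (\<Sum>w\<in>common_nbrs R u x. real (card (R `` {w})))"
      using card_UN_le[OF fcn, of "\<lambda>w. R `` {w}" x] by (simp flip: of_nat_sum)
    also have "\<dots> \<le> (\<Sum>w\<in>common_nbrs R u x. c * sqrt n)"
    proof (rule sum_mono)
      fix w assume "w \<in> common_nbrs R u x"
      then have "w \<in> V" using R_subset by (auto simp: common_nbrs_def)
      then show "real (card (R `` {w})) \<le> c * sqrt n" using max_deg by (simp add: n_def)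
    qed
    also have "\<dots> = card (common_nbrs R u x) * (c * sqrt n)" by simp
    also have "\<dots> \<le> T * (c * sqrt n)" using le cn by (intro mult_right_mono) auto
    finally show ?thesis .
  qed
  have "real (card (\<Union>x\<in>S. \<Union>w\<in>common_nbrs R u x. R `` {w}))
      \<le> (\<Sum>x\<in>S. real (card (\<Union>w\<in>common_nbrs R u x. R `` {w})))"
    using card_UN_le[OF \<open>finite S\<close>, of "\<lambda>x. \<Union>w\<in>common_nbrs R u x. R `` {w}"]
    by (simp flip: of_nat_sum)
  also have "\<dots> \<le> (\<Sum>x\<in>S. T * (c * sqrt n))" by (rule sum_mono) (rule union2)
  also have "\<dots> \<le> t * (T * (c * sqrt n))"
    using \<open>card S \<le> t\<close> cn by (simp add: mult_right_mono)
  finally have bad2: "real (card (\<Union>x\<in>S. \<Union>w\<in>common_nbrs R u x. R `` {w})) \<le> t * (T * (c * sqrt n))" .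
  have "real (card Bad) \<le> real (card (R `` {u})) + real (card (\<Union>x\<in>S. \<Union>w\<in>common_nbrs R u x. R `` {w}))"
    unfolding Bad_def of_nat_add[symmetric] of_nat_le_iff by (rule card_Un_le)
  also have "\<dots> \<le> c * sqrt n + t * (T * (c * sqrt n))"
    using bad2 max_deg[of u] u(1) \<open>U \<subseteq> V\<close> by (intro add_mono) (auto simp: n_def)
  also have "\<dots> = (1 + t * T) * c * sqrt n" by (simp add: algebra_simps)
  also have "\<dots> \<le> q * n"
  proof -
    have "(16 * t * T) * ((1 + t * T) * c) \<le> (16 * t * T) * (q * sqrt n)"
      using large2 by (simp add: q(2) n_def mult_ac)
    then have "(1 + t * T) * c \<le> q * sqrt n"
      using \<open>0 < t\<close> \<open>0 < T\<close> by (simp only: mult_le_cancel_left) auto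
    then have "(1 + t * T) * c * sqrt n \<le> q * sqrt n * sqrt n"
      using \<open>0 < n\<close> by (intro mult_right_mono) auto
    then show ?thesis using sqrt_n by (simp add: mult.assoc)
  qed
  finally have bad: "real (card Bad) \<le> q * n" .
  have fBad: "finite Bad" by (auto simp: Bad_def \<open>finite S\<close> fcn finite_nbrs)
  define U' where "U' = light T `` {u} \<inter> U - Bad"
  have "card (light T `` {u} \<inter> U) - card Bad \<le> card U'"
    unfolding U'_def by (rule diff_card_le_card_Diff[OF fBad])
  then have "q * n \<le> card U'" using u(2) bad by linarith
  moreover have "v \<notin> insert u S \<and> light_clique T (insert v (insert u S))" if "v \<in> U'" for v
  proof -
    have v: "(u, v) \<in> light T" "v \<in> U" "v \<notin> Bad" using that by (auto simp: U'_def)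
    have "u \<noteq> v" using v(1) by (auto simp: light_def)
    moreover have "light_clique T (insert v (insert u S))"
    proof (rule light_clique_insert2)
      show "(u, v) \<notin> R" using v(3) by (auto simp: Bad_def)
      show "common_nbrs R u x \<inter> R `` {v} = {}" if "x \<in> S" for x
        using v(3) that R_sym by (auto simp: Bad_def)
    qed (use S u(1) v in auto)
    ultimately show ?thesis using S[OF v(2)] by auto
  qed
  moreover have "U' \<subseteq> U" by (auto simp: U'_def)
  ultimately show ?thesis using u(1) unfolding n_def q_def by blast
qed


text \<open>Iterates \<open>light_clique_step\<close>. After \<open>k\<close> steps one vertex is
  still missing, and any remaining candidate completes the clique. The degree bound survives each
  step because the density only decreases.\<close>

lemma has_subdivided_clique_if_light_extensions:
  fixes c s :: real and t :: nat
  assumes "0 < t" and "0 \<le> c" and "V \<noteq> {}"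
    and max_deg: "\<And>v. v \<in> V \<Longrightarrow> card (R `` {v}) \<le> c * sqrt (card V)"
    and "U \<subseteq> V" and "0 < s" "s \<le> 1" and "s * card V \<le> card U"
    and "\<And>u. u \<in> U \<Longrightarrow> s * sqrt (card V) \<le> card (R `` {u})"
    and "finite S" and "card S + Suc k = t"
    and "\<And>u. u \<in> U \<Longrightarrow> u \<notin> S \<and> light_clique (t + t\<^sup>2) (insert u S)"
    and "ext_threshold t c k \<le> s ^ ext_exponent k * sqrt (card V)"
  shows "has_subdivided_clique t R"
  using assms(5-)
proof (induction k arbitrary: U S s)
  case 0
  have "0 < s * card V" using \<open>0 < s\<close> \<open>V \<noteq> {}\<close> finite_V by (simp add: card_gt_0_iff)
  then have "0 < card U" using "0.prems"(4) by linarith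
  then obtain u where u: "u \<in> U" by (metis card_gt_0_iff ex_in_conv)
  with "0.prems"(8) have "u \<notin> S" "light_clique (t + t\<^sup>2) (insert u S)" by auto
  then show ?case
    using "0.prems"(6,7) by (intro has_subdivided_clique_if_light_clique[of "t + t\<^sup>2" "insert u S"]) auto
next
  case (Suc k)
  define T where "T = t + t\<^sup>2"
  define d where "d = real (16 * t * T)"
  define a where "a = ext_exponent k"
  define K where "K = ext_threshold t c k"
  define K' where "K' = ext_threshold t c (Suc k)"
  have "1 \<le> 16 * t * T" using \<open>0 < t\<close> by (simp add: T_def)
  then have "1 \<le> d" unfolding d_def by linarith
  have "1 \<le> K" unfolding K_def using assms(1,2) by (rule ext_threshold_ge_1)
  have K'_eq: "K' = K * d ^ a + 8 * t + d * (1 + t * T) * c"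
    by (simp add: K'_def K_def a_def d_def T_def)
  \<comment> \<open>The three summands of the threshold serve, in this order, the induction
    hypothesis and the two largeness conditions of \<open>light_clique_step\<close>.\<close>
  have K': "K * d ^ a \<le> K'" "8 * t \<le> K'" "d * (1 + t * T) * c \<le> K'"
    using \<open>1 \<le> K\<close> \<open>1 \<le> d\<close> \<open>0 \<le> c\<close> by (auto simp: K'_eq add_nonneg_nonneg)
  \<comment> \<open>As s \<le> 1, lower powers of \<open>s\<close> are larger, so the single
    threshold hypothesis covers the exponents 2, 4 and 4a.\<close>
  have large_le: "K' \<le> s ^ m * sqrt (card V)" if "m \<le> 4 * a + 4" for m
  proof -
    have "s ^ (4 * a + 4) * sqrt (card V) \<le> s ^ m * sqrt (card V)"
      using Suc.prems(2,3) that by (intro mult_right_mono power_decreasing) auto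
    then show ?thesis using Suc.prems(9) by (simp add: K'_def a_def)
  qed
  define s' where "s' = s ^ 4 / d"
  have "0 < s'" using Suc.prems(2) \<open>1 \<le> d\<close> by (simp add: s'_def)
  have "s' \<le> s ^ 4" using Suc.prems(2) \<open>1 \<le> d\<close> by (simp add: s'_def divide_le_eq mult_le_cancel_left1)
  also have "\<dots> \<le> s ^ 1" using Suc.prems(2,3) by (intro power_decreasing) auto
  finally have "s' \<le> s" by simp
  show ?case
  proof (rule ccontr)
    assume no: "\<not> has_subdivided_clique t R"
    have "\<exists>u\<in>U. \<exists>U'\<subseteq>U. s ^ 4 / (16 * t * (t + t\<^sup>2)) * card V \<le> card U' \<and>
      (\<forall>v\<in>U'. v \<notin> insert u S \<and> light_clique (t + t\<^sup>2) (insert v (insert u S)))"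
    proof (rule light_clique_step[OF no \<open>0 < t\<close> \<open>V \<noteq> {}\<close> max_deg])
      show "8 * t \<le> s\<^sup>2 * sqrt (card V)" using large_le[of 2] K'(2) by simp
      show "16 * t * (t + t\<^sup>2) * (1 + t * (t + t\<^sup>2)) * c \<le> s ^ 4 * sqrt (card V)"
        using large_le[of 4] K'(3) by (simp add: d_def T_def del: mult_Suc_right)
    qed (use Suc.prems in auto)
    then obtain u U' where u: "u \<in> U" "U' \<subseteq> U" "s' * card V \<le> card U'"
      and U': "\<And>v. v \<in> U' \<Longrightarrow> v \<notin> insert u S \<and> light_clique (t + t\<^sup>2) (insert v (insert u S))"
      by (auto simp: s'_def d_def T_def)
    have "has_subdivided_clique t R"
    proof (rule Suc.IH[OF _ \<open>0 < s'\<close> _ u(3) _ _ _ U'])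
      show "U' \<subseteq> V" "s' \<le> 1" "finite (insert u S)" using u(2) Suc.prems \<open>s' \<le> s\<close> by auto
      show "s' * sqrt (card V) \<le> card (R `` {v})" if "v \<in> U'" for v
      proof -
        have "s' * sqrt (card V) \<le> s * sqrt (card V)" using \<open>s' \<le> s\<close> by (intro mult_right_mono) auto
        also have "\<dots> \<le> card (R `` {v})" using Suc.prems(5) u(2) that by auto
        finally show ?thesis .
      qed
      show "card (insert u S) + Suc k = t"
        using Suc.prems(6,7) Suc.prems(8)[OF u(1)] by simp
      have "K * d ^ a \<le> s ^ (4 * a) * sqrt (card V)" using large_le[of "4 * a"] K'(1) by simp
      then have "K \<le> s ^ (4 * a) * sqrt (card V) / d ^ a"
        using \<open>1 \<le> d\<close> by (simp add: pos_le_divide_eq)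
      then show "ext_threshold t c k \<le> s' ^ ext_exponent k * sqrt (card V)"
        by (simp add: s'_def power_divide power_mult K_def a_def)
    qed
    with no show False by simp
  qed
qed

end

section \<open>Edge bound in the absence of a subdivided clique\<close>

text \<open>Here \<open>card R\<close> counts every edge twice. If it were too large, deleting the
  edges at vertices of high degree would keep at least half of it, and the remaining vertices of at
  least half the average degree would be dense enough to start the light clique construction from
  the empty set.\<close>

lemma card_rel_le_if_no_subdivided_clique:
  assumes "0 < t"
  shows "\<exists>C \<delta> :: real. 0 < C \<and> 0 < \<delta> \<and> (\<forall>(V :: 'a set) R.
    finite_sym_rel V R \<longrightarrow> \<not> has_subdivided_clique t R \<longrightarrow>
    card R \<le> C * card V powr (3/2 - \<delta>))"
proof -
  define T where "T = t + t\<^sup>2"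
  \<comment> \<open>The summand 1 gives c \<ge> 1 and the strict inequality 8tTn < (c sqrt(n))^2
    needed for the high-degree bound.\<close>
  define c where "c = real (8 * t * T + 1)"
  have c: "1 \<le> c" by (simp add: c_def)
  obtain k where k: "Suc k = t" using \<open>0 < t\<close> by (metis gr0_implies_Suc)
  define a where "a = ext_exponent k"
  define K where "K = ext_threshold t c k"
  have "0 < a" unfolding a_def by (rule ext_exponent_pos)
  have "1 \<le> K" unfolding K_def using \<open>0 < t\<close> c by (intro ext_threshold_ge_1) auto
  \<comment> \<open>Chosen so that a density of order n^(-\<delta>), raised to the power
    \<open>a\<close>, is exactly balanced by sqrt(n).\<close>
  define \<delta> where "\<delta> = 1 / (2 * real a)"
  have \<delta>: "0 < \<delta>" "\<delta> \<le> 1 / 2" "a * \<delta> = 1 / 2" using \<open>0 < a\<close> by (auto simp: \<delta>_def field_simps)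
  \<comment> \<open>The summand 32t makes the loss of 16tn at most half of \<open>card R\<close>;
    the other one then gives the density bound for what remains.\<close>
  define C where "C = 4 * c * K + 32 * t"
  have C: "4 * c * K \<le> C" "32 * t \<le> C" "0 < C"
    using c \<open>1 \<le> K\<close> by (auto simp: C_def add_pos_nonneg)
  have "card R \<le> C * card V powr (3/2 - \<delta>)"
    if sym: "finite_sym_rel V R" and no: "\<not> has_subdivided_clique t R" for V :: "'a set" and R
  proof (rule ccontr)
    assume many: "\<not> ?thesis"
    interpret finite_sym_rel V R by fact
    have "R \<noteq> {}" using many C(3) by auto
    then have "V \<noteq> {}" using R_subset by auto
    define n where "n = real (card V)"
    have "0 < card V" using \<open>V \<noteq> {}\<close> finite_V by (simp add: card_gt_0_iff)
    then have n: "1 \<le> n" by (simp add: n_def)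
    define M where "M = c * sqrt n"
    define H where "H = {v \<in> V. M \<le> real (card (R `` {v}))}"
    have M_sq: "real (8 * t * (t + t\<^sup>2) * card V) < M\<^sup>2"
    proof -
      have "real (8 * t * T) * n < c * n" using n by (simp add: c_def algebra_simps)
      also have "\<dots> \<le> c * (c * n)" using c n by simp
      also have "\<dots> = M\<^sup>2" using n by (simp add: M_def power_mult_distrib power2_eq_square)
      finally show ?thesis by (simp add: T_def n_def)
    qed
    have "0 \<le> M" using c n by (simp add: M_def)
    then have high: "deg_sum H \<le> 8 * t * card V"
      using deg_sum_high_degree_le[OF no M_sq] by (simp add: H_def)
    have H: "H \<subseteq> V" "finite H" using finite_V by (auto simp: H_def)
    \<comment> \<open>The vertices of \<open>H\<close> become isolated but stay in \<open>V\<close>,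
      so \<open>n\<close> is unchanged.\<close>
    define R' where "R' = R \<inter> (V - H) \<times> (V - H)"
    have R': "R' \<subseteq> R" by (auto simp: R'_def)
    interpret R': finite_sym_rel V R'
      by unfold_locales (use finite_V R_subset R_sym R_irrefl in \<open>auto simp: R'_def irrefl_def intro!: symI\<close>)
    have no': "\<not> has_subdivided_clique t R'" using no R' has_subdivided_clique_mono by blast
    have finR: "finite R" using R_subset finite_V by (meson finite_SigmaI finite_subset)
    have "card R \<le> card R' + 16 * t * card V"
    proof -
      define I where "I = (SIGMA u:H. R `` {u})"
      have fI: "finite I" using H(2) finite_nbrs by (auto simp: I_def)
      have cI: "card I = deg_sum H" using H(2) finite_nbrs by (simp add: I_def deg_sum_def)
      \<comment> \<open>A deleted ordered pair has its first or its second entry in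
        \<open>H\<close>; this doubles the bound 8tn on the degree sum of \<open>H\<close>.\<close>
      have "R \<subseteq> R' \<union> (I \<union> prod.swap ` I)"
      proof
        fix p assume p: "p \<in> R"
        obtain u v where uv: "p = (u, v)" by (cases p)
        have "v \<in> H \<Longrightarrow> (v, u) \<in> I" using p R_sym by (auto simp: uv I_def)
        then have "v \<in> H \<Longrightarrow> p \<in> prod.swap ` I" by (force simp: uv)
        then show "p \<in> R' \<union> (I \<union> prod.swap ` I)" using p R_subset by (auto simp: R'_def I_def uv)
      qed
      then have "card R \<le> card (R' \<union> (I \<union> prod.swap ` I))"
        using fI finR R' by (intro card_mono) (auto intro: finite_subset)
      also have "\<dots> \<le> card R' + (card I + card (prod.swap ` I))"
        by (meson add_left_mono card_Un_le le_trans)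
      also have "card (prod.swap ` I) \<le> card I" by (rule card_image_le[OF fI])
      finally show ?thesis using high by (simp add: cI)
    qed
    then have "real (card R) \<le> real (card R' + 16 * t * card V)" by (simp only: of_nat_le_iff)
    then have R_le: "real (card R) \<le> real (card R') + 16 * t * n" by (simp add: n_def)
    have many': "C * n powr (3/2 - \<delta>) < card R" using many by (simp add: n_def)
    have "32 * t * n \<le> C * n powr (3/2 - \<delta>)"
    proof (rule mult_mono)
      have "n powr 1 \<le> n powr (3/2 - \<delta>)" using n \<delta> by (intro powr_mono) auto
      then show "n \<le> n powr (3/2 - \<delta>)" using n by simp
    qed (use C n in auto)
    then have R'_ge: "C / 2 * n powr (3/2 - \<delta>) \<le> card R'" using R_le many' by simp
    \<comment> \<open>With this normalisation the average degree in \<open>R'\<close> is 2sc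
      sqrt(n), and \<open>A\<close> below collects the vertices of at least half that
      degree.\<close>
    define s where "s = card R' / (2 * c * n * sqrt n)"
    have cR': "card R' = 2 * c * s * n * sqrt n" using c n by (simp add: s_def)
    have deg': "real (card (R' `` {v})) \<le> M" if "v \<in> V" for v
    proof (cases "v \<in> H")
      case True
      then have "R' `` {v} = {}" by (auto simp: R'_def)
      then show ?thesis using \<open>0 \<le> M\<close> by simp
    next
      case False
      have "card (R' `` {v}) \<le> card (R `` {v})" using R' finite_nbrs by (intro card_mono) auto
      then show ?thesis using False that by (simp add: H_def)
    qed
    have R'_sum: "real (card R') = (\<Sum>v\<in>V. real (card (R' `` {v})))"
      by (simp add: R'.deg_sum_V[symmetric] R'.deg_sum_def)
    have s_ge: "K * n powr - \<delta> \<le> s"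
    proof -
      have "4 * c * K * n powr (3/2 - \<delta>) \<le> C * n powr (3/2 - \<delta>)"
        using C(1) by (intro mult_right_mono) auto
      then have "2 * c * K * n powr (3/2 - \<delta>) \<le> card R'" using R'_ge by linarith
      moreover have "n powr (3/2 - \<delta>) = n * sqrt n * n powr - \<delta>"
      proof -
        have "n powr (3/2 - \<delta>) = n powr (1 + 1/2 + - \<delta>)" by (rule arg_cong[of _ _ "\<lambda>x. n powr x"]) simp
        also have "\<dots> = n powr 1 * n powr (1/2) * n powr - \<delta>" by (simp only: powr_add)
        finally show ?thesis using n by (simp add: powr_half_sqrt)
      qed
      ultimately have "(2 * c * n * sqrt n) * (K * n powr - \<delta>) \<le> card R'" by (simp add: mult_ac)
      then show ?thesis using c n by (simp add: s_def pos_le_divide_eq mult_ac)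
    qed
    have "0 < K * n powr - \<delta>" using \<open>1 \<le> K\<close> n by simp
    with s_ge have "0 < s" by linarith
    have "card R' \<le> (\<Sum>v\<in>V. M)" unfolding R'_sum by (rule sum_mono) (rule deg')
    also have "\<dots> = c * n * sqrt n" by (simp add: M_def n_def)
    finally have "s \<le> 1 / 2" using c n by (simp add: s_def divide_le_eq)
    define A where "A = {v \<in> V. s * c * sqrt n \<le> card (R' `` {v})}"
    have A: "A \<subseteq> V" "finite A" using finite_V by (auto simp: A_def)
    \<comment> \<open>Vertices outside \<open>A\<close> account for at most half of
      \<open>card R'\<close>; the other half comes from \<open>A\<close>, at most \<open>M\<close>
      per vertex.\<close>
    have "s * n \<le> card A"
    proof -
      have "card R' = (\<Sum>v\<in>V-A. real (card (R' `` {v}))) + (\<Sum>v\<in>A. real (card (R' `` {v})))"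
        unfolding R'_sum by (rule sum.subset_diff[OF A(1) finite_V])
      also have "\<dots> \<le> (\<Sum>v\<in>V-A. s * c * sqrt n) + (\<Sum>v\<in>A. M)"
        using deg' by (intro add_mono sum_mono) (auto simp: A_def)
      also have "(\<Sum>v\<in>V-A. s * c * sqrt n) \<le> (\<Sum>v\<in>V. s * c * sqrt n)"
        using finite_V c n \<open>0 < s\<close> by (intro sum_mono2) auto
      finally have "card R' \<le> n * (s * c * sqrt n) + card A * M" by (simp add: n_def)
      then have "(c * sqrt n) * (s * n) \<le> (c * sqrt n) * card A" by (simp add: cR' M_def mult_ac)
      then show ?thesis using c n by (simp only: mult_le_cancel_left) auto
    qed
    moreover have "K \<le> s ^ a * sqrt n"
    proof -
      have "K ^ 1 \<le> K ^ a" using \<open>1 \<le> K\<close> \<open>0 < a\<close> by (intro power_increasing) auto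
      moreover have "(n powr - \<delta>) ^ a * sqrt n = 1"
      proof -
        have "(n powr - \<delta>) ^ a = n powr (a * - \<delta>)" using n by (simp add: powr_power mult.commute)
        also have "\<dots> = n powr - (1/2)" by (simp only: mult_minus_right \<delta>(3))
        finally show ?thesis using n by (simp add: powr_minus powr_half_sqrt)
      qed
      ultimately have "K \<le> (K * n powr - \<delta>) ^ a * sqrt n" by (simp add: power_mult_distrib mult.assoc)
      also have "\<dots> \<le> s ^ a * sqrt n"
        using s_ge \<open>1 \<le> K\<close> n by (intro mult_right_mono power_mono) auto
      finally show ?thesis .
    qed
    moreover have "s * sqrt n \<le> card (R' `` {u})" if "u \<in> A" for u
    proof -
      have "s * sqrt n * 1 \<le> s * sqrt n * c" using c n \<open>0 < s\<close> by (intro mult_left_mono) auto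
      then show ?thesis using that by (simp add: A_def mult_ac)
    qed
    moreover have "R'.light_clique (t + t\<^sup>2) {u}" for u by (simp add: R'.light_clique_def)
    ultimately have "has_subdivided_clique t R'"
      using deg' A(1) \<open>0 < s\<close> \<open>s \<le> 1 / 2\<close> c k \<open>0 < t\<close> \<open>V \<noteq> {}\<close>
      by (intro R'.has_subdivided_clique_if_light_extensions[of t c A s "{}" k])
        (auto simp: n_def M_def K_def a_def)
    with no' show False by simp
  qed
  then show ?thesis using C(3) \<delta>(1) by blast
qed

section \<open>Extremal numbers\<close>

definition adj_rel :: "'a ugraph \<Rightarrow> 'a rel" where
  "adj_rel G = {(u, v). {u, v} \<in> edges G}"

lemma adj_rel_iff: "(u, v) \<in> adj_rel G \<longleftrightarrow> {u, v} \<in> edges G"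
  by (simp add: adj_rel_def)

lemma finite_sym_rel_adj_rel:
  assumes "simple_graph G"
  shows "finite_sym_rel (verts G) (adj_rel G)"
proof
  show "finite (verts G)" using assms by (simp add: simple_graph_def)
  show "adj_rel G \<subseteq> verts G \<times> verts G"
    using assms by (fastforce simp: simple_graph_def adj_rel_def doubleton_eq_iff)
  show "sym (adj_rel G)" by (auto simp: adj_rel_def insert_commute intro: symI)
  show "irrefl (adj_rel G)"
    using assms by (force simp: simple_graph_def adj_rel_def irrefl_def)
qed

lemma card_edges_le_card_adj_rel:
  assumes "simple_graph G"
  shows "card (edges G) \<le> card (adj_rel G)"
proof (rule surj_card_le)
  interpret finite_sym_rel "verts G" "adj_rel G" using assms by (rule finite_sym_rel_adj_rel)
  show "finite (adj_rel G)" using R_subset finite_V by (meson finite_SigmaI finite_subset)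
  show "edges G \<subseteq> (\<lambda>(u, v). {u, v}) ` adj_rel G"
    using assms by (force simp: simple_graph_def adj_rel_def)
qed

text \<open>Vertices of \<open>X\<close> become branch vertices and each \<open>y\<close> the middle
  vertex of the pair of its neighbours. Missing neighbours are replaced by dummy branch vertices
  reserved for \<open>y\<close>, at most two each, whence
  \<open>card X + 2 * card Y\<close>.\<close>

lemma contains_copy_if_has_subdivided_clique:
  fixes H :: "'a ugraph" and G :: "'b ugraph"
  assumes H: "simple_graph H" "bipartition H X Y" and deg: "\<forall>y \<in> Y. degree H y \<le> 2"
    and no_C4: "\<not> contains_copy H C4" and G: "simple_graph G"
    and sub: "has_subdivided_clique t (adj_rel G)" and t: "2 \<le> t" "card X + 2 * card Y \<le> t"
  shows "contains_copy G H"
proof -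
  have V: "verts H = X \<union> Y" "X \<inter> Y = {}"
    and edge: "\<And>e. e \<in> edges H \<Longrightarrow> \<exists>x\<in>X. \<exists>y\<in>Y. e = {x, y}"
    using H(2) by (auto simp: bipartition_def)
  have fin: "finite X" "finite Y" using H(1) V(1) by (auto simp: simple_graph_def)
  obtain S w where S: "finite S" "card S = t" and w: "subdivided_clique (adj_rel G) S w"
    using sub by (auto simp: has_subdivided_clique_def)
  define I where "I = {{u, v} |u v. u \<in> S \<and> v \<in> S \<and> u \<noteq> v}"
  have w_inj: "inj_on w I" using w by (simp add: subdivided_clique_def I_def)
  have w_adj: "(p, w i) \<in> adj_rel G" and w_notin: "w i \<notin> S" if i: "i \<in> I" and p: "p \<in> i" for i p
  proof -
    obtain u v where uv: "i = {u, v}" "u \<in> S" "v \<in> S" "u \<noteq> v" using i by (auto simp: I_def)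
    have "(u, w {u, v}) \<in> adj_rel G" "(v, w {v, u}) \<in> adj_rel G" "w {u, v} \<notin> S"
      using w uv(2-4) by (simp_all add: subdivided_clique_def)
    then show "(p, w i) \<in> adj_rel G" "w i \<notin> S"
      using p by (auto simp: uv(1) insert_commute)
  qed
  have adj_verts: "u \<in> verts G \<and> v \<in> verts G" if "(u, v) \<in> adj_rel G" for u v
    using that finite_sym_rel.R_subset[OF finite_sym_rel_adj_rel[OF G]] by auto
  \<comment> \<open>A branch vertex is known to lie in \<open>G\<close> only through an edge to a
    middle vertex, so a second branch vertex must exist; hence 2 \<le> t.\<close>
  have S_verts: "u \<in> verts G" if "u \<in> S" for u
  proof -
    have "\<not> S \<subseteq> {u}" using S t(1) card_mono[of "{u}" S] by auto
    then obtain v where "v \<in> S" "v \<noteq> u" by auto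
    then have "{u, v} \<in> I" using that by (auto simp: I_def)
    then show ?thesis using w_adj adj_verts by blast
  qed
  define nb where "nb y = {x \<in> X. {x, y} \<in> edges H}" for y
  have fin_nb: "finite (nb y)" for y using fin(1) by (simp add: nb_def)
  have nb_le: "card (nb y) \<le> 2" if "y \<in> Y" for y
  proof -
    have inj: "inj_on (\<lambda>x. {x, y}) (nb y)" by (auto simp: inj_on_def doubleton_eq_iff)
    have "(\<lambda>x. {x, y}) ` nb y = {e \<in> edges H. y \<in> e}"
      using edge V(2) that by (fastforce simp: nb_def)
    then have "card (nb y) = degree H y" unfolding degree_def by (metis card_image inj)
    then show ?thesis using deg that by simp
  qed
  \<comment> \<open>Labels for the branch vertices: \<open>Inl\<close> for \<open>X\<close>, and two
    dummy labels \<open>Inr (y, 0)\<close> and \<open>Inr (y, 1)\<close> for each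
    \<open>y\<close>.\<close>
  define J where "J = Inl ` X \<union> Inr ` (Y \<times> {..<2::nat})"
  have "card J = card X + 2 * card Y"
    unfolding J_def by (subst card_Un_disjoint) (auto simp: fin card_image card_cartesian_product)
  then obtain g where g: "g ` J \<subseteq> S" "inj_on g J"
    using card_le_inj[of J S] S t(2) fin by (auto simp: J_def)
  \<comment> \<open>The pair of labels of \<open>y\<close>: its true neighbours, filled up by its
    own dummies. The subtraction is exact because \<open>card (nb y)\<close> is at most 2.\<close>
  define Q where "Q y = Inl ` nb y \<union> Inr ` ({y} \<times> {..<2 - card (nb y)})" for y
  have Q_sub: "Q y \<subseteq> J" if "y \<in> Y" for y using that by (auto simp: Q_def J_def nb_def)
  have Q_card: "card (Q y) = 2" if "y \<in> Y" for y
    unfolding Q_def using nb_le[OF that]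
    by (subst card_Un_disjoint) (auto simp: fin_nb card_image card_cartesian_product)
  have Q_inj: "y = y'" if y: "y \<in> Y" "y' \<in> Y" "Q y = Q y'" for y y'
  proof (rule ccontr)
    assume "y \<noteq> y'"
    \<comment> \<open>A pair that was filled up contains the dummy \<open>Inr (z, 0)\<close>, which
      no other vertex uses.\<close>
    have full: "card (nb z) = 2" if "z \<in> Y" "Q z = Q z'" "z \<noteq> z'" for z z'
    proof (rule ccontr)
      assume "card (nb z) \<noteq> 2"
      then have "Inr (z, 0) \<in> Q z" using nb_le[OF that(1)] by (auto simp: Q_def)
      then have "Inr (z, 0) \<in> Q z'" using that(2) by simp
      then show False using that(3) by (auto simp: Q_def)
    qed
    have "card (nb y) = 2" "card (nb y') = 2"
      using full[of y y'] full[of y' y] y \<open>y \<noteq> y'\<close> by auto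
    have "nb z = Inl -` Q z" for z by (auto simp: Q_def)
    then have "nb y = nb y'" using y(3) by simp
    \<comment> \<open>Now y, a, y', b is a four-cycle in \<open>H\<close>.\<close>
    obtain a b where ab: "nb y = {a, b}" "a \<noteq> b"
      using \<open>card (nb y) = 2\<close> by (auto simp: card_2_iff)
    have "a \<in> nb y" "b \<in> nb y" "a \<in> nb y'" "b \<in> nb y'"
      using ab(1) \<open>nb y = nb y'\<close> by auto
    then have E: "{y, a} \<in> edges H" "{a, y'} \<in> edges H" "{y', b} \<in> edges H" "{b, y} \<in> edges H"
      and "a \<in> X" "b \<in> X"
      by (auto simp: nb_def insert_commute)
    then have "a \<noteq> y" "a \<noteq> y'" "b \<noteq> y" "b \<noteq> y'" using y V(2) by auto
    define f where "f n = (if n = 0 then y else if n = 1 then a else if n = 2 then y' else b)" for n :: nat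
    have "contains_copy H C4"
      unfolding contains_copy_def
    proof (intro exI[of _ f] conjI)
      show "inj_on f (verts C4)"
        using \<open>a \<noteq> y\<close> \<open>a \<noteq> y'\<close> \<open>b \<noteq> y\<close> \<open>b \<noteq> y'\<close> ab(2) \<open>y \<noteq> y'\<close> by (auto simp: C4_def f_def)
      show "f ` verts C4 \<subseteq> verts H"
        using \<open>a \<in> X\<close> \<open>b \<in> X\<close> y V(1) by (auto simp: C4_def f_def)
      show "\<forall>e\<in>edges C4. f ` e \<in> edges H" using E by (simp add: C4_def f_def insert_commute)
    qed
    with no_C4 show False by simp
  qed
  have gQ: "g ` Q y \<in> I" if "y \<in> Y" for y
  proof -
    have "card (g ` Q y) = 2"
      using Q_card[OF that] g(2) Q_sub[OF that] by (metis card_image inj_on_subset)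
    then obtain p q where pq: "g ` Q y = {p, q}" "p \<noteq> q" by (auto simp: card_2_iff)
    moreover have "g ` Q y \<subseteq> S" using g(1) Q_sub[OF that] by blast
    ultimately show ?thesis by (auto simp: I_def)
  qed
  have gQ_ne: "g ` Q y \<noteq> {}" if "y \<in> Y" for y using Q_card[OF that] by auto
  have wQ_inj: "y = y'" if "y \<in> Y" "y' \<in> Y" "w (g ` Q y) = w (g ` Q y')" for y y'
  proof -
    have "g ` Q y = g ` Q y'" using w_inj gQ that by (auto dest: inj_onD)
    then have "Q y = Q y'" using g(2) Q_sub that by (simp add: inj_on_image_eq_iff)
    then show ?thesis using Q_inj that by blast
  qed
  have wQ_notin: "w (g ` Q y) \<notin> S" if "y \<in> Y" for y
    using w_notin[OF gQ[OF that]] gQ_ne[OF that] by blast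
  have gX: "g (Inl x) \<in> S" if "x \<in> X" for x using g(1) that by (auto simp: J_def)
  have gX_inj: "x = x'" if "x \<in> X" "x' \<in> X" "g (Inl x) = g (Inl x')" for x x'
    using inj_onD[OF g(2) that(3)] that(1,2) by (auto simp: J_def)
  define f where "f v = (if v \<in> X then g (Inl v) else w (g ` Q v))" for v
  show ?thesis
    unfolding contains_copy_def
  proof (intro exI[of _ f] conjI)
    show "inj_on f (verts H)"
    proof (rule inj_onI)
      fix u v assume "u \<in> verts H" "v \<in> verts H" "f u = f v"
      then consider "u \<in> X" "v \<in> X" | "u \<in> X" "v \<in> Y" "v \<notin> X" | "u \<in> Y" "u \<notin> X" "v \<in> X"
        | "u \<in> Y" "u \<notin> X" "v \<in> Y" "v \<notin> X"
        using V(1) by blast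
      then show "u = v"
      proof cases
        case 1
        then show ?thesis using gX_inj \<open>f u = f v\<close> by (simp add: f_def)
      next
        case 2
        then show ?thesis using gX[of u] wQ_notin[of v] \<open>f u = f v\<close> by (simp add: f_def)
      next
        case 3
        then show ?thesis using gX[of v] wQ_notin[of u] \<open>f u = f v\<close> by (simp add: f_def)
      next
        case 4
        then show ?thesis using wQ_inj \<open>f u = f v\<close> by (simp add: f_def)
      qed
    qed
    show "f ` verts H \<subseteq> verts G"
    proof (rule image_subsetI)
      fix v assume v: "v \<in> verts H"
      show "f v \<in> verts G"
      proof (cases "v \<in> X")
        case True
        then show ?thesis using S_verts gX by (simp add: f_def)
      next
        case False
        then have "v \<in> Y" using v V(1) by auto
        then obtain p where "p \<in> g ` Q v" using gQ_ne by blast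
        then have "(p, w (g ` Q v)) \<in> adj_rel G" using w_adj gQ[OF \<open>v \<in> Y\<close>] by blast
        then show ?thesis using adj_verts False by (simp add: f_def)
      qed
    qed
    show "\<forall>e\<in>edges H. f ` e \<in> edges G"
    proof
      fix e assume "e \<in> edges H"
      then obtain x y where xy: "x \<in> X" "y \<in> Y" "e = {x, y}" using edge by blast
      then have "g (Inl x) \<in> g ` Q y" using \<open>e \<in> edges H\<close> by (auto simp: Q_def nb_def)
      then have "(g (Inl x), w (g ` Q y)) \<in> adj_rel G" using w_adj gQ[OF xy(2)] by blast
      moreover have "y \<notin> X" using xy(2) V(2) by auto
      ultimately show "f ` e \<in> edges G" using xy by (simp add: f_def adj_rel_iff insert_commute)
    qed
  qed
qed

theorem theorem1p3:
  fixes H :: "'a ugraph" and X Y :: "'a set"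
  assumes "simple_graph H"
    and "bipartition H X Y"
    and "\<forall>y \<in> Y. degree H y \<le> 2"
    and "\<not> contains_copy H C4"
  shows "\<exists>C \<delta> :: real. C > 0 \<and> \<delta> > 0 \<and>
    (\<forall>n :: nat. real (extremal_number n H) \<le> C * real n powr (3/2 - \<delta>))"
proof -
  \<comment> \<open>The final summand ensures 2 \<le> t even if \<open>H\<close> has no
    vertices.\<close>
  define t where "t = card X + 2 * card Y + 2"
  have t: "0 < t" "2 \<le> t" "card X + 2 * card Y \<le> t" by (simp_all add: t_def)
  obtain C \<delta> :: real where C: "0 < C" "0 < \<delta>" and bound: "\<And>(V :: nat set) R.
      finite_sym_rel V R \<Longrightarrow> \<not> has_subdivided_clique t R \<Longrightarrow>
      card R \<le> C * card V powr (3/2 - \<delta>)"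
    using card_rel_le_if_no_subdivided_clique[OF t(1), where 'a = nat] by blast
  have "real (extremal_number n H) \<le> C * real n powr (3/2 - \<delta>)" for n
  proof -
    define cands where "cands = {card (edges G) |G :: nat ugraph.
       simple_graph G \<and> verts G = {..<n} \<and> \<not> contains_copy G H}"
    have ex: "extremal_number n H = Sup cands" by (simp add: extremal_number_def cands_def)
    show ?thesis
    proof (cases "cands = {}")
      \<comment> \<open>If every graph on \<open>n\<close> vertices contains \<open>H\<close>, the
        extremal number is the default \<open>Sup {} = 0\<close> on the naturals.\<close>
      case True
      then show ?thesis using C by (simp add: ex Sup_nat_def)
    next
      case False
      have "finite cands" unfolding cands_def by (rule finite_extremal_candidates)
      then have "Sup cands \<in> cands" using False by (metis Max_in cSup_eq_Max)
      then obtain G :: "nat ugraph" where G: "simple_graph G" "verts G = {..<n}"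
        "\<not> contains_copy G H" "extremal_number n H = card (edges G)"
        by (auto simp: cands_def ex)
      have "\<not> has_subdivided_clique t (adj_rel G)"
        using contains_copy_if_has_subdivided_clique[OF assms G(1) _ t(2,3)] G(3) by blast
      then have "card (adj_rel G) \<le> C * card (verts G) powr (3/2 - \<delta>)"
        by (intro bound finite_sym_rel_adj_rel[OF G(1)])
      then show ?thesis
        using card_edges_le_card_adj_rel[OF G(1)] by (simp add: G(2,4))
    qed
  qed
  then show ?thesis using C by blast
qed

end
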